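(* Let $n,k\ge3$, $s\ge2$ and $1\le t\le\frac12(6k^2-15k+10)(s-1)+1$. Let $H$ be a connected linear $k$-graph on $n$ vertices. If $H$ contains neither a Berge-$B_s$ nor a Berge-$K_{2,t}$, then $$\rho(H)\le\sqrt{\frac{(6k^2-15k+10)(s-1)(n-1)}{2(k-1)^2}}.$$
   Context: A $k$-graph ($k$-uniform hypergraph) $H$ consists of a finite vertex set $V(H)$ and a set $E(H)$ of $k$-element subsets of $V(H)$ (edges). $H$ is linear if any two distinct edges share at most one vertex. Two vertices are adjacent if some edge contains both; $H$ is connected if the graph on $V(H)$ with this adjacency relation is connected. For $V(H)=\{v_1,\dots,v_n\}$, the adjacency tensor $\mathcal{A}(H)=(a_{i_1\dots i_k})$ is the order-$k$, dimension-$n$ tensor with $a_{i_1\dots i_k}=\frac{1}{(k-1)!}$ if $\{v_{i_1},\dots,v_{i_k}\}\in E(H)$ and $0$ otherwise. A number $\lambda\in\mathbb{C}$ is an eigenvalue of an order-$k$ dimension-$n$ tensor $\mathcal{A}=(a_{i_1\dots i_k})$ if there is a nonzero $\mathbf{x}\in\mathbb{C}^n$ with $\sum_{i_2,\dots,i_k=1}^n a_{i i_2\dots i_k}x_{i_2}\cdots x_{i_k}=\lambda x_i^{k-1}$ for all $i$; the spectral radius is the largest modulus of an eigenvalue. $\rho(H)$ denotes the spectral radius of $\mathcal{A}(H)$. For a graph $G$, a hypergraph $F$ is a Berge-$G$ if there is a bijection $\varphi:E(G)\to E(F)$ with $e\subseteq\varphi(e)$ for every $e\in E(G)$; $H$ contains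 a Berge-$G$ if some subhypergraph of $H$ is a Berge-$G$. The $s$-book $B_s$ is the graph consisting of $s$ triangles sharing one common edge (vertices $x,y,w_1,\dots,w_s$, edges $xy$, $xw_i$, $yw_i$). $K_{2,t}$ is the complete bipartite graph with parts of sizes $2$ and $t$. *)

theory Defs
  imports Complex_Main
begin

definition k_graph :: "nat \<Rightarrow> 'a set \<Rightarrow> 'a set set \<Rightarrow> bool" where
  "k_graph k V E \<longleftrightarrow> finite V \<and> (\<forall>e\<in>E. e \<subseteq> V \<and> card e = k)"

definition linear_hypergraph :: "'a set set \<Rightarrow> bool" where
  "linear_hypergraph E \<longleftrightarrow> (\<forall>e\<in>E. \<forall>f\<in>E. e \<noteq> f \<longrightarrow> card (e \<inter> f) \<le> 1)"

definition adjacency :: "'a set \<Rightarrow> 'a set set \<Rightarrow> ('a \<times> 'a) set" where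
  "adjacency V E = {(u, v). u \<in> V \<and> v \<in> V \<and> u \<noteq> v \<and> (\<exists>e\<in>E. u \<in> e \<and> v \<in> e)}"

definition connected_hypergraph :: "'a set \<Rightarrow> 'a set set \<Rightarrow> bool" where
  "connected_hypergraph V E \<longleftrightarrow> V \<noteq> {} \<and> (\<forall>u\<in>V. \<forall>v\<in>V. (u, v) \<in> (adjacency V E)\<^sup>*)"

text \<open>
  A tensor of order \<open>k\<close> and dimension \<open>n\<close> is a function on the lists of length \<open>k\<close> over a
  finite index set \<open>I\<close> with \<open>n\<close> elements; its values on other lists play no role.
  The list \<open>[i\<^sub>1, \<dots>, i\<^sub>k]\<close> is the multi-index \<open>i\<^sub>1 \<dots> i\<^sub>k\<close>.
\<close>

definition tensor_eigenvalue ::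
    "nat \<Rightarrow> 'i set \<Rightarrow> ('i list \<Rightarrow> complex) \<Rightarrow> complex \<Rightarrow> bool" where
  "tensor_eigenvalue k I A c \<longleftrightarrow>
     (\<exists>x :: 'i \<Rightarrow> complex. (\<exists>i\<in>I. x i \<noteq> 0) \<and>
        (\<forall>i\<in>I. (\<Sum>js | set js \<subseteq> I \<and> length js = k - 1. A (i # js) * prod_list (map x js))
                = c * x i ^ (k - 1)))"

text \<open>
  The moduli of the eigenvalues are bounded by the largest absolute row sum, and the supremum
  is the largest modulus whenever there is one.
\<close>

definition tensor_spectral_radius :: "nat \<Rightarrow> 'i set \<Rightarrow> ('i list \<Rightarrow> complex) \<Rightarrow> real" where
  "tensor_spectral_radius k I A = Sup {cmod c | c. tensor_eigenvalue k I A c}"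

text \<open>The vertices themselves serve as the indices of the adjacency tensor.\<close>

definition adjacency_tensor :: "nat \<Rightarrow> 'a set set \<Rightarrow> 'a list \<Rightarrow> complex" where
  "adjacency_tensor k E is = (if set is \<in> E then 1 / fact (k - 1) else 0)"

definition hypergraph_spectral_radius :: "nat \<Rightarrow> 'a set \<Rightarrow> 'a set set \<Rightarrow> real" where
  "hypergraph_spectral_radius k V E = tensor_spectral_radius k V (adjacency_tensor k E)"

text \<open>
  Graphs and hypergraphs are pairs of a vertex set and an edge set. The injection \<open>f\<close>
  identifies the vertices of \<open>G\<close> with vertices of \<open>F\<close>, which makes the inclusion of an edge
  of \<open>G\<close> in an edge of \<open>F\<close> meaningful for a graph \<open>G\<close> given up to isomorphism.
\<close>

definition is_berge :: "'b set \<times> 'b set set \<Rightarrow> 'a set \<times> 'a set set \<Rightarrow> bool" where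
  "is_berge G F \<longleftrightarrow>
     (\<exists>f \<phi>. inj_on f (fst G) \<and> f ` fst G \<subseteq> fst F \<and> bij_betw \<phi> (snd G) (snd F) \<and>
        (\<forall>e\<in>snd G. f ` e \<subseteq> \<phi> e))"

definition contains_berge :: "'a set \<Rightarrow> 'a set set \<Rightarrow> 'b set \<times> 'b set set \<Rightarrow> bool" where
  "contains_berge V E G \<longleftrightarrow>
     (\<exists>V' E'. V' \<subseteq> V \<and> E' \<subseteq> E \<and> (\<forall>e\<in>E'. e \<subseteq> V') \<and> is_berge G (V', E'))"

text \<open>In the book, \<open>x = 0\<close>, \<open>y = 1\<close> and the \<open>w\<^sub>i\<close> are \<open>2, \<dots>, s + 1\<close>.\<close>

definition book_graph :: "nat \<Rightarrow> nat set \<times> nat set set" where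
  "book_graph s =
     ({..<s + 2}, insert {0, 1} ((\<lambda>i. {0, i}) ` {2..<s + 2} \<union> (\<lambda>i. {1, i}) ` {2..<s + 2}))"

definition complete_bipartite_graph :: "nat \<Rightarrow> nat \<Rightarrow> nat set \<times> nat set set" where
  "complete_bipartite_graph m t = ({..<m + t}, {{a, b} | a b. a < m \<and> m \<le> b \<and> b < m + t})"

end

theory Submission
  imports Defs "HOL-Analysis.Convex" "HOL-Combinatorics.Multiset_Permutations"
begin

text \<open>
  For an eigenvector \<open>x\<close>, the AM-GM inequality applied to each edge shows that
  \<open>z = |x|\<^sup>k\<^sup>-\<^sup>1\<close> satisfies \<open>(k - 1) |\<lambda>| z\<^sub>v \<le> \<Sum>\<^sub>w z\<^sub>w\<close>, the sum ranging over the neighbours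
  of \<open>v\<close>. Applying this twice at a maximum of \<open>z\<close> bounds \<open>((k - 1) |\<lambda>|)\<^sup>2\<close> by the number of walks
  \<open>v, w, u\<close> of length two from some vertex \<open>v\<close>.

  Let \<open>N\<close> be the neighbourhood of \<open>v\<close>, and let \<open>\<tau> = (2k - 3)(s - 1)\<close>. A maximal family of
  non-conflicting triangles on an adjacent pair is smaller than \<open>s\<close>, so such a pair has at most \<open>\<tau>\<close>
  common neighbours outside its edge. Hence at most \<open>|N| (k - 1 + \<tau>)\<close> walks end in \<open>N \<union> {v}\<close>.
  For \<open>u\<close> outside \<open>N \<union> {v}\<close>, discard a middle vertex \<open>w\<close> if an earlier middle vertex (in a fixed
  order) lies on a common edge with \<open>w\<close> and one of \<open>u, v\<close>. The remaining ones span a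
  Berge-\<open>K\<^sub>2\<^sub>,\<^sub>t\<close> if there are \<open>t\<close> of them, and the book condition bounds the number of discarded walks,
  over all \<open>u\<close>, by \<open>|N| (k - 2) \<tau>\<close>. With \<open>C = (6k\<^sup>2 - 15k + 10)(s - 1)/2\<close>, both \<open>t - 1\<close> and
  \<open>(k - 1)(1 + \<tau>)\<close> are at most \<open>C\<close>, so there are at most \<open>C (n - 1)\<close> walks.
\<close>

section \<open>Mean inequality, independent sets and a criterion for Berge copies\<close>

text \<open>This is AM-GM for the numbers \<open>y i ^ card S\<close>, whose geometric mean is the
  plain product of the \<open>y i\<close>.\<close>

lemma prod_le_mean_power:
  fixes y :: "'a \<Rightarrow> real"
  assumes "finite S" "S \<noteq> {}" and nonneg: "\<And>i. i \<in> S \<Longrightarrow> 0 \<le> y i"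
  shows "(\<Prod>i\<in>S. y i) \<le> (\<Sum>i\<in>S. y i ^ card S) / card S"
proof -
  have pos: "card S > 0" using assms by (simp add: card_gt_0_iff)
  have P: "0 \<le> (\<Prod>i\<in>S. y i)" using nonneg by (simp add: prod_nonneg)
  have "(\<Prod>i\<in>S. y i ^ card S) powr (1 / card S) \<le> (\<Sum>i\<in>S. y i ^ card S / card S)"
    by (rule arith_geom_mean) (use assms in auto)
  moreover have "(\<Prod>i\<in>S. y i ^ card S) = (\<Prod>i\<in>S. y i) powr card S"
    using P pos by (simp add: prod_power_distrib powr_realpow')
  ultimately show ?thesis
    using P pos by (simp add: powr_powr sum_divide_distrib)
qed

text \<open>A maximal \<open>R\<close>-independent subset of \<open>T\<close> dominates
  \<open>T\<close>, since an element unrelated to all of it could be added. So at most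
  \<open>m\<close> neighbourhoods of size at most \<open>d\<close> cover \<open>T\<close>.\<close>

lemma card_le_maximal_independent:
  assumes "finite T"
    and refl: "\<And>z. z \<in> T \<Longrightarrow> R z z"
    and deg: "\<And>z. z \<in> T \<Longrightarrow> card {z' \<in> T. R z z'} \<le> d"
    and indep: "\<And>S. \<lbrakk>S \<subseteq> T; \<And>z z'. \<lbrakk>z \<in> S; z' \<in> S; z \<noteq> z'\<rbrakk> \<Longrightarrow> \<not> R z z'\<rbrakk> \<Longrightarrow> card S \<le> m"
    and sym: "\<And>z z'. R z z' \<Longrightarrow> R z' z"
  shows "card T \<le> m * d"
proof -
  define I where "I = {S. S \<subseteq> T \<and> (\<forall>z\<in>S. \<forall>z'\<in>S. z \<noteq> z' \<longrightarrow> \<not> R z z')}"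
  have "finite I" using assms(1) by (simp add: I_def)
  moreover have "{} \<in> I" by (simp add: I_def)
  ultimately obtain S where S: "S \<in> I" "\<And>S'. S' \<in> I \<Longrightarrow> S \<subseteq> S' \<Longrightarrow> S' = S"
    using finite_has_maximal[of I] by blast
  have fS: "finite S" using S(1) assms(1) by (auto simp: I_def intro: finite_subset)
  have cover: "T \<subseteq> (\<Union>z\<in>S. {z' \<in> T. R z z'})"
  proof
    fix w assume w: "w \<in> T"
    show "w \<in> (\<Union>z\<in>S. {z' \<in> T. R z z'})"
    proof (rule ccontr)
      assume n: "w \<notin> (\<Union>z\<in>S. {z' \<in> T. R z z'})"
      then have "insert w S \<in> I" using S(1) w sym by (auto simp: I_def)
      then have "w \<in> S" using S(2) by blast
      then show False using n w refl by blast
    qed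
  qed
  have "card T \<le> card (\<Union>z\<in>S. {z' \<in> T. R z z'})"
    using cover fS assms(1) by (intro card_mono) auto
  also have "\<dots> \<le> (\<Sum>z\<in>S. card {z' \<in> T. R z z'})"
    by (rule card_UN_le[OF fS])
  also have "\<dots> \<le> card S * d"
    using deg S(1) by (intro sum_bounded_above[THEN order_trans]) (auto simp: I_def)
  also have "\<dots> \<le> m * d"
    using indep[of S] S(1) by (auto simp: I_def)
  finally show ?thesis .
qed

lemma card_Sigma_le:
  assumes "finite A" "\<And>a. a \<in> A \<Longrightarrow> finite (B a)" "\<And>a. a \<in> A \<Longrightarrow> card (B a) \<le> d"
  shows "card (SIGMA a:A. B a) \<le> card A * d"
  using assms sum_bounded_above[of A "\<lambda>a. card (B a)" d] by simp

text \<open>If no edge of \<open>E\<close> can host two edges of \<open>G\<close>, every choice of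
  hosts is injective, so hosts may be picked independently of each other.\<close>

lemma contains_bergeI:
  assumes "inj_on f (fst G)" "f ` fst G \<subseteq> V" "\<And>e. e \<in> E \<Longrightarrow> e \<subseteq> V"
    and ex: "\<And>e. e \<in> snd G \<Longrightarrow> \<exists>h\<in>E. f ` e \<subseteq> h"
    and sep: "\<And>e e' h. \<lbrakk>e \<in> snd G; e' \<in> snd G; e \<noteq> e'; h \<in> E; f ` e \<subseteq> h; f ` e' \<subseteq> h\<rbrakk> \<Longrightarrow> False"
  shows "contains_berge V E G"
proof -
  obtain \<phi> where \<phi>: "\<And>e. e \<in> snd G \<Longrightarrow> \<phi> e \<in> E \<and> f ` e \<subseteq> \<phi> e"
    using ex by metis
  have "inj_on \<phi> (snd G)"
    by (rule inj_onI) (metis sep \<phi>)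
  then have "is_berge G (V, \<phi> ` snd G)"
    unfolding is_berge_def using assms(1,2) \<phi>
    by (intro exI[of _ f] exI[of _ \<phi>]) (simp add: bij_betw_def)
  then show ?thesis
    unfolding contains_berge_def using \<phi> assms(3) by (intro exI[of _ V] exI[of _ "\<phi> ` snd G"]) auto
qed

section \<open>Edges and neighbourhoods in linear hypergraphs\<close>

locale linear_k_graph =
  fixes k :: nat and V :: "'a set" and E :: "'a set set"
  assumes k_graph: "k_graph k V E" and linear: "linear_hypergraph E"
begin

text \<open>For distinct adjacent \<open>a\<close>, \<open>b\<close>, linearity makes this
  membership of \<open>c\<close> in their unique common edge. Repeated arguments are allowed:
  \<open>coedge x z z\<close> only says that some edge contains \<open>x\<close> and
  \<open>z\<close>.\<close>

definition coedge :: "'a \<Rightarrow> 'a \<Rightarrow> 'a \<Rightarrow> bool" where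
  "coedge a b c \<longleftrightarrow> (\<exists>e\<in>E. a \<in> e \<and> b \<in> e \<and> c \<in> e)"

definition nbhd :: "'a \<Rightarrow> 'a set" where
  "nbhd a = {b. b \<noteq> a \<and> (\<exists>e\<in>E. a \<in> e \<and> b \<in> e)}"

text \<open>For adjacent \<open>x\<close>, \<open>y\<close> these are the third vertices of
  triangles whose three sides lie in three different edges, the candidates for the pages of a
  book.\<close>

definition apexes :: "'a \<Rightarrow> 'a \<Rightarrow> 'a set" where
  "apexes x y = {z \<in> nbhd x \<inter> nbhd y. \<not> coedge x y z}"

lemma finite_V [simp]: "finite V"
  and edge_subset: "e \<in> E \<Longrightarrow> e \<subseteq> V"
  and card_edge: "e \<in> E \<Longrightarrow> card e = k"
  using k_graph by (auto simp: k_graph_def)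

lemma finite_E [simp]: "finite E"
  by (rule finite_subset[of _ "Pow V"]) (use edge_subset in auto)

lemma finite_edge: "e \<in> E \<Longrightarrow> finite e"
  using edge_subset finite_V finite_subset by blast

lemma nbhd_subset: "nbhd a \<subseteq> V - {a}"
  using edge_subset by (auto simp: nbhd_def)

lemma finite_nbhd [simp]: "finite (nbhd a)"
  using nbhd_subset finite_V finite_subset by blast

lemma finite_apexes [simp]: "finite (apexes x y)"
  by (simp add: apexes_def)

lemma nbhd_sym: "b \<in> nbhd a \<longleftrightarrow> a \<in> nbhd b"
  by (auto simp: nbhd_def)

lemma edge_unique:
  assumes "e \<in> E" "f \<in> E" "a \<noteq> b" "a \<in> e" "b \<in> e" "a \<in> f" "b \<in> f"
  shows "e = f"
proof (rule ccontr)
  assume "e \<noteq> f"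
  then have "card (e \<inter> f) \<le> 1" using linear assms by (auto simp: linear_hypergraph_def)
  moreover have "card {a, b} \<le> card (e \<inter> f)"
    using assms finite_edge by (intro card_mono) auto
  ultimately show False using assms by simp
qed

lemma coedge_edge_iff:
  assumes "e \<in> E" "a \<noteq> b" "a \<in> e" "b \<in> e"
  shows "coedge a b c \<longleftrightarrow> c \<in> e"
  using assms edge_unique unfolding coedge_def by metis

lemma finite_coedge [simp]: "finite {c. coedge a b c}"
  by (rule finite_subset[OF _ finite_V]) (use edge_subset in \<open>auto simp: coedge_def\<close>)

lemma card_coedge:
  assumes "b \<in> nbhd a"
  shows "card {c. coedge a b c} = k"
proof -
  obtain e where "e \<in> E" "a \<in> e" "b \<in> e" "a \<noteq> b" using assms by (auto simp: nbhd_def)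
  then have "{c. coedge a b c} = e" using coedge_edge_iff by blast
  then show ?thesis using \<open>e \<in> E\<close> card_edge by simp
qed

lemma card_coedge_minus:
  assumes "b \<in> nbhd a"
  shows "card ({c. coedge a b c} - {a, b}) = k - 2"
    and "card ({c. coedge a b c} - {b}) = k - 1"
proof -
  have "a \<in> {c. coedge a b c}" "b \<in> {c. coedge a b c}" "a \<noteq> b"
    using assms by (auto simp: nbhd_def coedge_def)
  then show "card ({c. coedge a b c} - {a, b}) = k - 2"
    "card ({c. coedge a b c} - {b}) = k - 1"
    using card_coedge[OF assms] by (simp_all add: card_Diff_subset)
qed

text \<open>By linearity the edges at \<open>v\<close>, with \<open>v\<close> removed, partition the
  neighbourhood of \<open>v\<close>.\<close>

lemma sum_edges_at:
  fixes z :: "'a \<Rightarrow> real"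
  shows "(\<Sum>e | e \<in> E \<and> v \<in> e. \<Sum>w\<in>e - {v}. z w) = (\<Sum>w\<in>nbhd v. z w)"
proof -
  have "nbhd v = (\<Union>e\<in>{e \<in> E. v \<in> e}. e - {v})"
    by (auto simp: nbhd_def)
  moreover have "(e - {v}) \<inter> (f - {v}) = {}" if "e \<in> E" "v \<in> e" "f \<in> E" "v \<in> f" "e \<noteq> f" for e f
    using that edge_unique by blast
  ultimately show ?thesis
    using finite_edge by (simp add: sum.UNION_disjoint del: UN_simps)
qed

section \<open>Eigenvalues and walks of length two\<close>

text \<open>Each edge at \<open>i\<close> contributes one term per ordering of its other
  \<open>k - 1\<close> vertices, which cancels the factor \<open>1 / fact (k - 1)\<close>. AM-GM
  then replaces each product of moduli by a mean of powers, whose denominator supplies the factor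
  \<open>k - 1\<close>.\<close>

lemma eigenvector_nbhd_bound:
  assumes k: "k \<ge> 2" and i: "i \<in> V"
    and eig: "(\<Sum>js | set js \<subseteq> V \<and> length js = k - 1.
        adjacency_tensor k E (i # js) * prod_list (map x js)) = c * x i ^ (k - 1)"
  shows "(real k - 1) * cmod c * cmod (x i) ^ (k - 1) \<le> (\<Sum>w\<in>nbhd i. cmod (x w) ^ (k - 1))"
proof -
  define L where "L = {js. set js \<subseteq> V \<and> length js = k - 1}"
  define Ei where "Ei = {e \<in> E. i \<in> e}"
  define y where "y w = cmod (x w)" for w
  have fL: "finite L" unfolding L_def by (rule finite_lists_length_eq) simp
  have card_e: "card (e - {i}) = k - 1" if "e \<in> Ei" for e
    using that card_edge finite_edge by (simp add: Ei_def)
  \<comment> \<open>An edge has \<open>k\<close> elements and \<open>i # js\<close> has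
    \<open>k\<close> entries, so only lists without repetition give nonzero entries of the
    tensor.\<close>
  have L_edge: "{js \<in> L. set (i # js) \<in> E} = (\<Union>e\<in>Ei. permutations_of_set (e - {i}))"
  proof (intro equalityI subsetI)
    fix js assume "js \<in> {js \<in> L. set (i # js) \<in> E}"
    then have js: "set js \<subseteq> V" "length js = k - 1" "set (i # js) \<in> E" by (auto simp: L_def)
    have "card (set (i # js)) = length (i # js)" using js k card_edge by simp
    then have "distinct (i # js)" by (rule card_distinct)
    then have "js \<in> permutations_of_set (set (i # js) - {i})" by auto
    then show "js \<in> (\<Union>e\<in>Ei. permutations_of_set (e - {i}))"
      using js(3) by (auto simp: Ei_def)
  next
    fix js assume "js \<in> (\<Union>e\<in>Ei. permutations_of_set (e - {i}))"
    then obtain e where e: "e \<in> Ei" "set js = e - {i}" "distinct js"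
      by (auto simp: permutations_of_set_def)
    then have "length js = k - 1" using card_e distinct_card by metis
    moreover have "set (i # js) = e" using e by (auto simp: Ei_def)
    ultimately show "js \<in> {js \<in> L. set (i # js) \<in> E}"
      using e edge_subset by (auto simp: L_def Ei_def)
  qed
  have norm_prod: "cmod (prod_list (map x js)) = prod_list (map y js)" for js
    by (induction js) (auto simp: norm_mult y_def)
  have "cmod c * y i ^ (k - 1) = cmod (c * x i ^ (k - 1))"
    by (simp add: norm_mult norm_power y_def)
  also have "\<dots> = cmod (\<Sum>js\<in>L. adjacency_tensor k E (i # js) * prod_list (map x js))"
    using eig by (simp add: L_def)
  also have "\<dots> \<le> (\<Sum>js\<in>L. cmod (adjacency_tensor k E (i # js) * prod_list (map x js)))"
    by (rule norm_sum)
  also have "\<dots> = (\<Sum>js\<in>L. if set (i # js) \<in> E then prod_list (map y js) / fact (k - 1) else 0)"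
    by (intro sum.cong) (auto simp: adjacency_tensor_def norm_mult norm_divide norm_prod)
  also have "\<dots> = (\<Sum>js\<in>{js \<in> L. set (i # js) \<in> E}. prod_list (map y js) / fact (k - 1))"
    using fL by (rule sum.inter_filter[symmetric])
  also have "\<dots> = (\<Sum>e\<in>Ei. \<Sum>js\<in>permutations_of_set (e - {i}). prod_list (map y js) / fact (k - 1))"
    unfolding L_edge
  proof (rule sum.UNION_disjoint)
    show "\<forall>e\<in>Ei. \<forall>f\<in>Ei. e \<noteq> f \<longrightarrow> permutations_of_set (e - {i}) \<inter> permutations_of_set (f - {i}) = {}"
      by (auto simp: Ei_def permutations_of_set_def)
  qed (auto simp: Ei_def)
  also have "\<dots> = (\<Sum>e\<in>Ei. \<Prod>w\<in>e - {i}. y w)"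
  proof (rule sum.cong)
    fix e assume e: "e \<in> Ei"
    then have fe: "finite (e - {i})" using finite_edge by (auto simp: Ei_def)
    have "(\<Sum>js\<in>permutations_of_set (e - {i}). prod_list (map y js) / fact (k - 1))
        = (\<Sum>js\<in>permutations_of_set (e - {i}). (\<Prod>w\<in>e - {i}. y w) / fact (k - 1))"
    proof (rule sum.cong)
      fix js assume "js \<in> permutations_of_set (e - {i})"
      then have "prod_list (map y js) = (\<Prod>w\<in>e - {i}. y w)"
        using permutations_of_setD prod.distinct_set_conv_list by metis
      then show "prod_list (map y js) / fact (k - 1) = (\<Prod>w\<in>e - {i}. y w) / fact (k - 1)"
        by (rule arg_cong)
    qed simp
    also have "\<dots> = fact (k - 1) * ((\<Prod>w\<in>e - {i}. y w) / fact (k - 1))"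
      by (simp only: sum_constant card_permutations_of_set[OF fe] card_e[OF e] of_nat_fact)
    finally show "(\<Sum>js\<in>permutations_of_set (e - {i}). prod_list (map y js) / fact (k - 1))
        = (\<Prod>w\<in>e - {i}. y w)"
      by simp
  qed simp
  also have "\<dots> \<le> (\<Sum>e\<in>Ei. (\<Sum>w\<in>e - {i}. y w ^ (k - 1)) / real (k - 1))"
  proof (rule sum_mono)
    fix e assume e: "e \<in> Ei"
    then have "finite (e - {i})" using finite_edge by (auto simp: Ei_def)
    moreover have "0 < card (e - {i})" using card_e[OF e] k by linarith
    then have "e - {i} \<noteq> {}" unfolding card_gt_0_iff by blast
    ultimately show "(\<Prod>w\<in>e - {i}. y w) \<le> (\<Sum>w\<in>e - {i}. y w ^ (k - 1)) / real (k - 1)"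
      using prod_le_mean_power[of "e - {i}" y] card_e[OF e] by (simp add: y_def)
  qed
  also have "\<dots> = (\<Sum>w\<in>nbhd i. y w ^ (k - 1)) / real (k - 1)"
    using sum_edges_at[where v = i and z = "\<lambda>w. y w ^ (k - 1)"]
    by (simp add: Ei_def flip: sum_divide_distrib)
  finally show ?thesis
    using k by (simp add: y_def of_nat_diff field_simps)
qed

text \<open>At a vertex maximizing \<open>z\<close>, every end of a two-step walk contributes at
  most \<open>z v\<close>. This value is positive because the eigenvector is nonzero on
  \<open>V\<close>, so it cancels.\<close>

lemma eigenvalue_two_walk_bound:
  assumes k: "k \<ge> 2" and "tensor_eigenvalue k V (adjacency_tensor k E) c"
    and M: "\<And>v. v \<in> V \<Longrightarrow> (\<Sum>w\<in>nbhd v. real (card (nbhd w))) \<le> M"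
  shows "((real k - 1) * cmod c)\<^sup>2 \<le> M"
proof -
  obtain x where x: "\<exists>i\<in>V. x i \<noteq> 0"
    "\<forall>i\<in>V. (\<Sum>js | set js \<subseteq> V \<and> length js = k - 1.
        adjacency_tensor k E (i # js) * prod_list (map x js)) = c * x i ^ (k - 1)"
    using assms(2) unfolding tensor_eigenvalue_def by blast
  define z where "z w = cmod (x w) ^ (k - 1)" for w
  define r where "r = (real k - 1) * cmod c"
  have r: "0 \<le> r" using k by (simp add: r_def)
  have step: "r * z v \<le> (\<Sum>w\<in>nbhd v. z w)" if "v \<in> V" for v
    using eigenvector_nbhd_bound[OF k that x(2)[rule_format, OF that]] by (simp add: r_def z_def)
  have "finite (z ` V)" "z ` V \<noteq> {}" using x(1) by auto
  from Max_in[OF this] obtain v where v: "v \<in> V" "z v = Max (z ` V)" by auto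
  have zmax: "z u \<le> z v" if "u \<in> V" for u using v that by simp
  obtain i where "i \<in> V" "x i \<noteq> 0" using x(1) by blast
  then have "0 < z i" by (simp add: z_def)
  then have "0 < z v" using zmax[OF \<open>i \<in> V\<close>] by linarith
  have "r\<^sup>2 * z v = r * (r * z v)" by (simp add: power2_eq_square)
  also have "\<dots> \<le> r * (\<Sum>w\<in>nbhd v. z w)" using step[OF v(1)] r by (rule mult_left_mono)
  also have "\<dots> = (\<Sum>w\<in>nbhd v. r * z w)" by (rule sum_distrib_left)
  also have "\<dots> \<le> (\<Sum>w\<in>nbhd v. \<Sum>u\<in>nbhd w. z u)"
    using step nbhd_subset by (intro sum_mono) blast
  also have "\<dots> \<le> (\<Sum>w\<in>nbhd v. \<Sum>u\<in>nbhd w. z v)"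
    using zmax nbhd_subset by (intro sum_mono) blast
  also have "\<dots> = (\<Sum>w\<in>nbhd v. real (card (nbhd w))) * z v"
    by (simp add: sum_distrib_right)
  also have "\<dots> \<le> M * z v" using M v \<open>0 < z v\<close> by (intro mult_right_mono) auto
  finally show ?thesis using \<open>0 < z v\<close> by (simp add: r_def)
qed

section \<open>Berge copies from conflict-free families\<close>

text \<open>The conditions say that no edge can host two of the pairs joining \<open>x\<close> or
  \<open>y\<close> to \<open>S\<close>. Adjacency of \<open>x\<close> and \<open>y\<close> is left
  open, so that the notion serves both forbidden graphs.\<close>

definition separated :: "'a \<Rightarrow> 'a \<Rightarrow> 'a set \<Rightarrow> bool" where
  "separated x y S \<longleftrightarrow> S \<subseteq> nbhd x \<inter> nbhd y \<and> (\<forall>z\<in>S. \<not> coedge x y z) \<and>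
     (\<forall>z\<in>S. \<forall>z'\<in>S. z \<noteq> z' \<longrightarrow> \<not> coedge x z z' \<and> \<not> coedge y z z')"

lemma separated_subset: "separated x y S \<Longrightarrow> S' \<subseteq> S \<Longrightarrow> separated x y S'"
  unfolding separated_def by blast

text \<open>The numbering is the one common to \<open>book_graph\<close> and
  \<open>complete_bipartite_graph 2\<close>: the centres are 0 and 1, and \<open>S\<close> starts at
  2.\<close>

lemma separated_labelling:
  assumes sep: "separated x y S" and xy: "x \<in> V" "y \<in> V" "x \<noteq> y"
  obtains f where "f 0 = x" "f 1 = y" "inj_on f {..<card S + 2}" "f ` {..<card S + 2} \<subseteq> V"
    "\<forall>i\<in>{2..<card S + 2}. f i \<in> nbhd x \<and> f i \<in> nbhd y"
    "\<forall>i\<in>{2..<card S + 2}. \<forall>h\<in>E. f i \<in> h \<longrightarrow> x \<notin> h \<or> y \<notin> h"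
    "\<forall>i\<in>{2..<card S + 2}. \<forall>j\<in>{2..<card S + 2}. \<forall>h\<in>E.
       i \<noteq> j \<longrightarrow> f i \<in> h \<longrightarrow> f j \<in> h \<longrightarrow> x \<notin> h \<and> y \<notin> h"
proof -
  have S: "S \<subseteq> V" "x \<notin> S" "y \<notin> S" using sep nbhd_subset by (auto simp: separated_def)
  then have "finite S" using finite_subset finite_V by blast
  then obtain g where g: "bij_betw g {2..<card S + 2} S"
    using finite_same_card_bij[of "{2..<card S + 2}" S] by auto
  define f where "f i = (if i = 0 then x else if i = 1 then y else g i)" for i :: nat
  have f01: "f 0 = x" "f 1 = y" by (auto simp: f_def)
  have "bij_betw f {2..<card S + 2} S \<longleftrightarrow> bij_betw g {2..<card S + 2} S"
    by (rule bij_betw_cong) (auto simp: f_def)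
  with g have inj: "inj_on f {2..<card S + 2}" and im: "f ` {2..<card S + 2} = S"
    by (auto simp: bij_betw_def)
  have split: "{..<card S + 2} = insert 0 (insert 1 {2..<card S + 2})" by auto
  have mem: "f i \<in> S" if "i \<in> {2..<card S + 2}" for i using im that by blast
  show ?thesis
  proof
    show "inj_on f {..<card S + 2}"
      unfolding split using inj im f01 S(2,3) xy(3) by (auto simp: inj_on_insert image_iff)
    show "f ` {..<card S + 2} \<subseteq> V"
      unfolding split image_insert im using f01 S(1) xy by simp
    show "\<forall>i\<in>{2..<card S + 2}. f i \<in> nbhd x \<and> f i \<in> nbhd y"
      using mem sep unfolding separated_def by blast
    show "\<forall>i\<in>{2..<card S + 2}. \<forall>h\<in>E. f i \<in> h \<longrightarrow> x \<notin> h \<or> y \<notin> h"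
      using mem sep unfolding separated_def coedge_def by blast
    show "\<forall>i\<in>{2..<card S + 2}. \<forall>j\<in>{2..<card S + 2}. \<forall>h\<in>E.
       i \<noteq> j \<longrightarrow> f i \<in> h \<longrightarrow> f j \<in> h \<longrightarrow> x \<notin> h \<and> y \<notin> h"
    proof (intro ballI impI)
      fix i j h
      assume *: "i \<in> {2..<card S + 2}" "j \<in> {2..<card S + 2}" "h \<in> E" "i \<noteq> j" "f i \<in> h" "f j \<in> h"
      have "f i \<noteq> f j" using inj * by (meson inj_onD)
      then have "\<not> coedge x (f i) (f j)" "\<not> coedge y (f i) (f j)"
        using mem * sep unfolding separated_def by blast+
      then show "x \<notin> h \<and> y \<notin> h" using * unfolding coedge_def by blast
    qed
  qed (fact f01)+
qed

text \<open>An edge hosting two pairs with the same end in \<open>S\<close> would contain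
  \<open>x\<close> and \<open>y\<close>, against \<open>one\<close>; with different ends it would
  contain two elements of \<open>S\<close> and a centre, against \<open>two\<close>.\<close>

lemma separated_imp_complete_bipartite:
  assumes sep: "separated x y S" and xy: "x \<in> V" "y \<in> V" "x \<noteq> y"
  shows "contains_berge V E (complete_bipartite_graph 2 (card S))"
proof -
  obtain f where f: "f 0 = x" "f 1 = y" "inj_on f {..<card S + 2}" "f ` {..<card S + 2} \<subseteq> V"
    and nb: "\<forall>i\<in>{2..<card S + 2}. f i \<in> nbhd x \<and> f i \<in> nbhd y"
    and one: "\<forall>i\<in>{2..<card S + 2}. \<forall>h\<in>E. f i \<in> h \<longrightarrow> x \<notin> h \<or> y \<notin> h"
    and two: "\<forall>i\<in>{2..<card S + 2}. \<forall>j\<in>{2..<card S + 2}. \<forall>h\<in>E.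
       i \<noteq> j \<longrightarrow> f i \<in> h \<longrightarrow> f j \<in> h \<longrightarrow> x \<notin> h \<and> y \<notin> h"
    using separated_labelling[OF assms] .
  have fstG: "fst (complete_bipartite_graph 2 (card S)) = {..<card S + 2}"
    by (auto simp: complete_bipartite_graph_def)
  have edges: "\<exists>a i. (a = 0 \<or> a = 1) \<and> i \<in> {2..<card S + 2} \<and> e = {a, i}"
    if "e \<in> snd (complete_bipartite_graph 2 (card S))" for e
    using that by (auto simp: complete_bipartite_graph_def less_2_cases_iff)
  show ?thesis
  proof (rule contains_bergeI)
    fix e assume "e \<in> snd (complete_bipartite_graph 2 (card S))"
    then obtain a i where i: "a = 0 \<or> a = 1" "i \<in> {2..<card S + 2}" "e = {a, i}" using edges by blast
    then show "\<exists>h\<in>E. f ` e \<subseteq> h" using bspec[OF nb i(2)] f(1,2) by (auto simp: nbhd_def)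
  next
    fix e e' h
    assume e: "e \<in> snd (complete_bipartite_graph 2 (card S))"
        "e' \<in> snd (complete_bipartite_graph 2 (card S))"
      and ne: "e \<noteq> e'" and h: "h \<in> E" "f ` e \<subseteq> h" "f ` e' \<subseteq> h"
    obtain a i where i: "a = 0 \<or> a = 1" "i \<in> {2..<card S + 2}" "e = {a, i}"
      using edges[OF e(1)] by blast
    obtain b j where j: "b = 0 \<or> b = 1" "j \<in> {2..<card S + 2}" "e' = {b, j}"
      using edges[OF e(2)] by blast
    have mem: "f a \<in> h" "f i \<in> h" "f b \<in> h" "f j \<in> h" using h i(3) j(3) by auto
    show False
    proof (cases "i = j")
      case True
      then have "a \<noteq> b" using ne i(3) j(3) by blast
      then have "x \<in> h" "y \<in> h" using mem i(1) j(1) f(1,2) by auto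
      then show False using one i(2) h(1) mem by blast
    next
      case False
      then show False using two[rule_format, OF i(2) j(2) h(1) False] mem i(1) f(1,2) by auto
    qed
  next
    show "e \<subseteq> V" if "e \<in> E" for e using edge_subset[OF that] .
  qed (use f fstG in simp_all)
qed

text \<open>Adjacency gives a host for the spine \<open>{0, 1}\<close>. An edge containing
  \<open>x\<close> and \<open>y\<close> misses \<open>S\<close> and hosts nothing else; the
  remaining collisions are as in the bipartite case.\<close>

lemma separated_imp_book:
  assumes sep: "separated x y S" and xy: "y \<in> nbhd x"
  shows "contains_berge V E (book_graph (card S))"
proof -
  have V: "x \<in> V" "y \<in> V" "x \<noteq> y" using xy nbhd_subset nbhd_sym by blast+
  obtain f where f: "f 0 = x" "f 1 = y" "inj_on f {..<card S + 2}" "f ` {..<card S + 2} \<subseteq> V"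
    and nb: "\<forall>i\<in>{2..<card S + 2}. f i \<in> nbhd x \<and> f i \<in> nbhd y"
    and one: "\<forall>i\<in>{2..<card S + 2}. \<forall>h\<in>E. f i \<in> h \<longrightarrow> x \<notin> h \<or> y \<notin> h"
    and two: "\<forall>i\<in>{2..<card S + 2}. \<forall>j\<in>{2..<card S + 2}. \<forall>h\<in>E.
       i \<noteq> j \<longrightarrow> f i \<in> h \<longrightarrow> f j \<in> h \<longrightarrow> x \<notin> h \<and> y \<notin> h"
    using separated_labelling[OF sep V] .
  have fstG: "fst (book_graph (card S)) = {..<card S + 2}"
    by (simp add: book_graph_def)
  have edges: "e = {0, 1} \<or> (\<exists>a\<in>{0, 1}. \<exists>i\<in>{2..<card S + 2}. e = {a, i})"
    if "e \<in> snd (book_graph (card S))" for e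
    using that unfolding book_graph_def by auto
  show ?thesis
  proof (rule contains_bergeI)
    fix e assume e: "e \<in> snd (book_graph (card S))"
    show "\<exists>h\<in>E. f ` e \<subseteq> h"
    proof (cases "e = {0, 1}")
      case True
      then show ?thesis using xy f(1,2) by (auto simp: nbhd_def)
    next
      case False
      then obtain a i where i: "a = 0 \<or> a = 1" "i \<in> {2..<card S + 2}" "e = {a, i}"
        using edges[OF e] by blast
      then show ?thesis using bspec[OF nb i(2)] f(1,2) by (auto simp: nbhd_def)
    qed
  next
    fix e e' h
    assume e: "e \<in> snd (book_graph (card S))" "e' \<in> snd (book_graph (card S))"
      and ne: "e \<noteq> e'" and h: "h \<in> E" "f ` e \<subseteq> h" "f ` e' \<subseteq> h"
    show False
    proof (cases "x \<in> h \<and> y \<in> h")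
      case True
      obtain a i where "i \<in> {2..<card S + 2}" "e = {a, i} \<or> e' = {a, i}"
        using edges[OF e(1)] edges[OF e(2)] ne by blast
      then show False using bspec[OF bspec[OF one, of i] h(1)] h True by auto
    next
      case False
      then have not01: "e \<noteq> {0, 1}" "e' \<noteq> {0, 1}" using h f(1,2) by auto
      obtain a i where i: "a = 0 \<or> a = 1" "i \<in> {2..<card S + 2}" "e = {a, i}"
        using edges[OF e(1)] not01 by blast
      obtain b j where j: "b = 0 \<or> b = 1" "j \<in> {2..<card S + 2}" "e' = {b, j}"
        using edges[OF e(2)] not01 by blast
      have mem: "f a \<in> h" "f i \<in> h" "f b \<in> h" "f j \<in> h" using h i(3) j(3) by auto
      have "a = b" using mem i(1) j(1) f(1,2) False by auto
      then have "i \<noteq> j" using ne i(3) j(3) by blast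
      then show False using two[rule_format, OF i(2) j(2) h(1)] mem i(1) f(1,2) by auto
    qed
  next
    show "e \<subseteq> V" if "e \<in> E" for e using edge_subset[OF that] .
  qed (use f fstG in simp_all)
qed

section \<open>Counting walks of length two\<close>

text \<open>An apex \<open>z\<close> conflicts with itself and with at most \<open>k - 2\<close>
  others on each of the edges through \<open>x z\<close> and \<open>y z\<close>, which makes
  \<open>2 * k - 3\<close>. A conflict-free family is separated, so \<open>s\<close> of its members
  would span a book.\<close>

lemma card_apexes_le:
  assumes k: "k \<ge> 2" and xy: "y \<in> nbhd x" and "s \<ge> 1"
    and no_book: "\<not> contains_berge V E (book_graph s)"
  shows "card (apexes x y) \<le> (s - 1) * (2 * k - 3)"
proof (rule card_le_maximal_independent[where R = "\<lambda>z z'. coedge x z z' \<or> coedge y z z'"])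
  fix z assume z: "z \<in> apexes x y"
  then have nz: "z \<in> nbhd x" "z \<in> nbhd y" by (auto simp: apexes_def)
  then show "coedge x z z \<or> coedge y z z" by (auto simp: nbhd_def coedge_def)
  let ?A = "{c. coedge x z c} - {x, z}" and ?B = "{c. coedge y z c} - {y, z}"
  have "{z' \<in> apexes x y. coedge x z z' \<or> coedge y z z'} \<subseteq> {z} \<union> (?A \<union> ?B)"
    by (auto simp: apexes_def nbhd_def)
  moreover have "finite ?A" "finite ?B" by auto
  ultimately have "card {z' \<in> apexes x y. coedge x z z' \<or> coedge y z z'} \<le> card ({z} \<union> (?A \<union> ?B))"
    by (intro card_mono) auto
  also have "\<dots> \<le> 1 + (card ?A + card ?B)"
    using card_Un_le[of "{z}" "?A \<union> ?B"] card_Un_le[of ?A ?B] by simp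
  also have "\<dots> = 2 * k - 3" using card_coedge_minus nz k by simp
  finally show "card {z' \<in> apexes x y. coedge x z z' \<or> coedge y z z'} \<le> 2 * k - 3" .
next
  fix S assume S: "S \<subseteq> apexes x y"
    "\<And>z z'. \<lbrakk>z \<in> S; z' \<in> S; z \<noteq> z'\<rbrakk> \<Longrightarrow> \<not> (coedge x z z' \<or> coedge y z z')"
  then have sep: "separated x y S" by (auto simp: separated_def apexes_def)
  show "card S \<le> s - 1"
  proof (rule ccontr)
    assume "\<not> card S \<le> s - 1"
    then have "s \<le> card S" by simp
    then obtain S' where "S' \<subseteq> S" "card S' = s" using obtain_subset_with_card_n by metis
    then show False using separated_imp_book[OF separated_subset[OF sep] xy] no_book by blast
  qed
qed (auto simp: coedge_def)

text \<open>Per neighbour of \<open>v\<close>, the three summands count walks ending on the edge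
  through \<open>v\<close> and the middle vertex, walks ending elsewhere in the neighbourhood, and
  discarded walks. Each vertex further out keeps at most \<open>m\<close> middle vertices.\<close>

lemma two_walks_le:
  assumes k: "k \<ge> 2" and v: "v \<in> V"
    and \<tau>: "\<And>x y. y \<in> nbhd x \<Longrightarrow> card (apexes x y) \<le> \<tau>"
    and m: "\<And>u S. \<lbrakk>u \<in> V; u \<noteq> v; u \<notin> nbhd v; separated v u S\<rbrakk> \<Longrightarrow> card S \<le> m"
  shows "(\<Sum>w\<in>nbhd v. card (nbhd w))
    \<le> card (nbhd v) * ((k - 1) + \<tau> + (k - 2) * \<tau>) + (card V - 1 - card (nbhd v)) * m"
proof -
  define N where "N = nbhd v"
  define U where "U = V - insert v N"
  obtain g :: "'a \<Rightarrow> nat" where g: "inj_on g V"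
    using finite_imp_inj_to_nat_seg[OF finite_V] by blast
  have NV: "N \<subseteq> V" "v \<notin> N" using nbhd_subset by (auto simp: N_def)
  have fN: "finite N" and fU: "finite U" by (auto simp: N_def U_def)
  have cardU: "card U = card V - 1 - card N"
    unfolding U_def using NV v fN by (subst card_Diff_subset) auto
  \<comment> \<open>The injection \<open>g\<close> supplies the order. An earlier conflicting vertex
    counts even if it is discarded itself; of any two conflicting vertices the later one is bad, so
    \<open>good u\<close> is separated.\<close>
  define bad where "bad u = {w \<in> N \<inter> nbhd u. \<exists>w'\<in>N \<inter> nbhd u.
      g w' < g w \<and> (coedge v w w' \<or> coedge u w w')}" for u
  define good where "good u = N \<inter> nbhd u - bad u" for u
  \<comment> \<open>\<open>A0\<close> includes the walks returning to \<open>v\<close>. The other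
    three sets list the end of the walk first, hence the later \<open>prod.swap\<close>; in
    \<open>A1\<close> this lets the apexes of the adjacent pair \<open>v u\<close> count the middle
    vertices.\<close>
  define A0 where "A0 = (SIGMA w:N. {u. coedge v w u} - {w})"
  define A1 where "A1 = (SIGMA u:N. apexes v u)"
  define G where "G = (SIGMA u:U. good u)"
  define B where "B = (SIGMA u:U. bad u)"
  define Q where "Q = {(w, w', u). w \<in> N \<and> w' \<in> N \<and> w \<noteq> w' \<and> u \<in> U \<and> w \<in> nbhd u \<and> w' \<in> nbhd u \<and>
      (coedge v w w' \<or> coedge u w w')}"
  \<comment> \<open>If the conflict of \<open>w\<close> and \<open>w'\<close> is on an edge through
    \<open>v\<close>, that edge misses \<open>u\<close>, which is then an apex of
    \<open>w w'\<close>. Otherwise \<open>w'\<close> is an apex of \<open>v w\<close>, and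
    \<open>u\<close> lies on the edge through \<open>w\<close> and \<open>w'\<close>. Both ways give
    at most \<open>(k - 2) * \<tau>\<close> choices per \<open>w\<close>.\<close>
  define Q1 where "Q1 = (SIGMA w:N. SIGMA w':{c. coedge v w c} - {v, w}. apexes w w')"
  define Q2 where "Q2 = (SIGMA w:N. SIGMA w':apexes v w. {c. coedge w w' c} - {w, w'})"
  have fin: "finite A0" "finite A1" "finite G" "finite B"
    using fN fU by (auto simp: A0_def A1_def G_def B_def good_def bad_def)
  have cA0: "card A0 \<le> card N * (k - 1)"
    unfolding A0_def using fN card_coedge_minus(2)
    by (intro card_Sigma_le) (auto simp: N_def)
  have cA1: "card A1 \<le> card N * \<tau>"
    unfolding A1_def using fN \<tau> by (intro card_Sigma_le) (auto simp: N_def)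
  have cG: "card G \<le> card U * m"
    unfolding G_def
  proof (rule card_Sigma_le[OF fU])
    fix u assume u: "u \<in> U"
    show "finite (good u)" by (simp add: good_def)
    have "separated v u (good u)"
      unfolding separated_def
    proof (intro conjI ballI impI)
      fix z assume "z \<in> good u"
      show "\<not> coedge v u z" using u by (auto simp: U_def N_def nbhd_def coedge_def)
    next
      fix z z' assume z: "z \<in> good u" "z' \<in> good u" "z \<noteq> z'"
      then have "z \<in> V" "z' \<in> V" using NV by (auto simp: good_def)
      then have "g z < g z' \<or> g z' < g z" using g z by (metis inj_onD nat_neq_iff)
      moreover have "\<not> (coedge v a b \<or> coedge u a b)"
        if "a \<in> good u" "b \<in> good u" "g b < g a" for a b
        using that unfolding good_def bad_def by blast
      ultimately show "\<not> coedge v z z'" "\<not> coedge u z z'"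
        using z(1,2) unfolding coedge_def by blast+
    qed (auto simp: good_def N_def)
    then show "card (good u) \<le> m" using m u by (auto simp: U_def N_def)
  qed
  have fQ1: "finite Q1"
    unfolding Q1_def using fN by (intro finite_SigmaI) simp_all
  have fQ2: "finite Q2"
    unfolding Q2_def using fN by (intro finite_SigmaI) simp_all
  have cQ1: "card Q1 \<le> card N * ((k - 2) * \<tau>)"
    unfolding Q1_def
  proof (rule card_Sigma_le[OF fN])
    fix w assume w: "w \<in> N"
    let ?S = "SIGMA w':{c. coedge v w c} - {v, w}. apexes w w'"
    show "finite ?S" by (intro finite_SigmaI) simp_all
    have "card ?S \<le> card ({c. coedge v w c} - {v, w}) * \<tau>"
    proof (rule card_Sigma_le)
      fix w' assume "w' \<in> {c. coedge v w c} - {v, w}"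
      then have "w' \<in> nbhd w" by (auto simp: nbhd_def coedge_def)
      then show "card (apexes w w') \<le> \<tau>" by (rule \<tau>)
    qed simp_all
    then show "card ?S \<le> (k - 2) * \<tau>" using card_coedge_minus(1) w by (simp add: N_def)
  qed
  have cQ2: "card Q2 \<le> card N * ((k - 2) * \<tau>)"
    unfolding Q2_def
  proof (rule card_Sigma_le[OF fN])
    fix w assume w: "w \<in> N"
    let ?S = "SIGMA w':apexes v w. {c. coedge w w' c} - {w, w'}"
    show "finite ?S" by (intro finite_SigmaI) simp_all
    have "card ?S \<le> card (apexes v w) * (k - 2)"
      using card_coedge_minus(1) by (intro card_Sigma_le) (simp_all add: apexes_def)
    also have "\<dots> \<le> \<tau> * (k - 2)" using \<tau> w by (intro mult_right_mono) (auto simp: N_def)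
    finally show "card ?S \<le> (k - 2) * \<tau>" by (simp add: mult.commute)
  qed
  have QQ: "Q \<subseteq> Q1 \<union> Q2"
  proof
    fix q assume "q \<in> Q"
    then obtain w w' u where q: "q = (w, w', u)" and w: "w \<in> N" "w' \<in> N" "w \<noteq> w'" "u \<in> U"
      "w \<in> nbhd u" "w' \<in> nbhd u" and co: "coedge v w w' \<or> coedge u w w'" by (auto simp: Q_def)
    have not3: "\<not> (u \<in> e \<and> v \<in> e)" if "e \<in> E" for e
      using w that by (auto simp: U_def N_def nbhd_def)
    have nb: "w \<in> nbhd v" "v \<in> nbhd w" "w' \<in> nbhd v" "u \<in> nbhd w" "u \<in> nbhd w'"
      using w by (auto simp: N_def nbhd_def)
    show "q \<in> Q1 \<union> Q2"
    proof (cases "coedge v w w'")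
      case True
      then obtain e where e: "e \<in> E" "v \<in> e" "w \<in> e" "w' \<in> e" by (auto simp: coedge_def)
      then have "\<not> coedge w w' u" using coedge_edge_iff[of e w w' u] w not3 by blast
      then show ?thesis using True nb w NV q by (auto simp: Q1_def apexes_def)
    next
      case False
      then obtain e where e: "e \<in> E" "u \<in> e" "w \<in> e" "w' \<in> e" using co by (auto simp: coedge_def)
      then have "w' \<in> nbhd w" "coedge w w' u" using w by (auto simp: nbhd_def coedge_def)
      moreover have "u \<noteq> w" "u \<noteq> w'" using w by (auto simp: U_def)
      ultimately show ?thesis using False nb w q by (auto simp: Q2_def apexes_def)
    qed
  qed
  then have fQ: "finite Q" using fQ1 fQ2 finite_subset by blast
  have cQ: "card Q \<le> 2 * (card N * ((k - 2) * \<tau>))"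
    using card_mono[OF _ QQ] card_Un_le[of Q1 Q2] fQ1 fQ2 cQ1 cQ2 by simp
  \<comment> \<open>\<open>Q\<close> is symmetric in \<open>w, w'\<close>, and a discarded walk is witnessed only by a triple with
    \<open>g w' < g w\<close>: this halves the count, without which the bound can exceed \<open>C\<close>.\<close>
  define Ql where "Ql = {(w, w', u) \<in> Q. g w' < g w}"
  define Qr where "Qr = {(w, w', u) \<in> Q. g w < g w'}"
  have "bij_betw (\<lambda>(w, w', u). (w', w, u)) Ql Qr"
    by (rule bij_betwI[where g = "\<lambda>(w, w', u). (w', w, u)"])
      (auto simp: Ql_def Qr_def Q_def coedge_def)
  then have "card Ql = card Qr" by (rule bij_betw_same_card)
  moreover have "card Ql + card Qr = card (Ql \<union> Qr)"
    using fQ by (intro card_Un_disjoint[symmetric]) (auto simp: Ql_def Qr_def intro: finite_subset)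
  moreover have "card (Ql \<union> Qr) \<le> card Q"
    using fQ by (intro card_mono) (auto simp: Ql_def Qr_def)
  ultimately have cQl: "card Ql \<le> card N * ((k - 2) * \<tau>)" using cQ by simp
  \<comment> \<open>Each discarded walk has at least one witness \<open>w'\<close>; the projection
    forgets it.\<close>
  have "B \<subseteq> (\<lambda>(w, w', u). (u, w)) ` Ql"
    by (fastforce simp: B_def bad_def Ql_def Q_def image_iff)
  moreover have fQl: "finite Ql" using fQ by (auto simp: Ql_def intro: finite_subset)
  ultimately have "card B \<le> card Ql"
    by (meson card_image_le card_mono finite_imageI le_trans)
  then have cB: "card B \<le> card N * ((k - 2) * \<tau>)" using cQl by simp
  have "(SIGMA w:N. nbhd w) \<subseteq> A0 \<union> prod.swap ` (A1 \<union> (G \<union> B))"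
  proof
    fix p assume "p \<in> (SIGMA w:N. nbhd w)"
    then obtain w u where p: "p = (w, u)" "w \<in> N" "u \<in> nbhd w" by auto
    show "p \<in> A0 \<union> prod.swap ` (A1 \<union> (G \<union> B))"
    proof (cases "coedge v w u")
      case True
      then show ?thesis using p by (auto simp: A0_def nbhd_def)
    next
      case False
      have "v \<noteq> u" using False p by (auto simp: N_def nbhd_def coedge_def)
      have w: "w \<in> nbhd u" "u \<in> V" using p nbhd_sym nbhd_subset by blast+
      have "(u, w) \<in> A1 \<union> (G \<union> B)"
      proof (cases "u \<in> N")
        case True
        then show ?thesis using False p w by (auto simp: A1_def apexes_def N_def coedge_def)
      next
        case uN: False
        then show ?thesis using p w \<open>v \<noteq> u\<close> by (auto simp: G_def B_def good_def U_def)
      qed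
      then show ?thesis using p by force
    qed
  qed
  then have "card (SIGMA w:N. nbhd w) \<le> card (A0 \<union> prod.swap ` (A1 \<union> (G \<union> B)))"
    using fin by (intro card_mono) auto
  also have "\<dots> \<le> card A0 + card (prod.swap ` (A1 \<union> (G \<union> B)))" by (rule card_Un_le)
  also have "\<dots> \<le> card A0 + card (A1 \<union> (G \<union> B))"
    using fin by (intro add_left_mono card_image_le) auto
  also have "\<dots> \<le> card A0 + (card A1 + (card G + card B))"
    using card_Un_le[of A1 "G \<union> B"] card_Un_le[of G B] by linarith
  also have "\<dots> \<le> card N * (k - 1) + (card N * \<tau> + (card U * m + card N * ((k - 2) * \<tau>)))"
    using cA0 cA1 cG cB by linarith
  finally show ?thesis
    using fN by (simp add: cardU algebra_simps flip: N_def)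
qed

section \<open>The bound on the spectral radius\<close>

text \<open>Bounding the \<open>Sup\<close> requires some eigenvalue to exist. The indicator of a
  single vertex \<open>v\<close> works for 0: a nonzero product forces all entries of
  \<open>js\<close> to be \<open>v\<close>, and \<open>{i, v}\<close> is too small to contain an
  edge.\<close>

lemma zero_eigenvalue:
  assumes "k \<ge> 3" "V \<noteq> {}"
  shows "tensor_eigenvalue k V (adjacency_tensor k E) 0"
proof -
  obtain v where v: "v \<in> V" using assms by blast
  define x :: "'a \<Rightarrow> complex" where "x i = (if i = v then 1 else 0)" for i
  have "adjacency_tensor k E (i # js) * prod_list (map x js) = 0" for i js
  proof (cases "set js \<subseteq> {v}")
    case True
    then have "card (set (i # js)) \<le> card {i, v}" by (intro card_mono) auto
    also have "\<dots> \<le> 2" by (simp add: card_insert_if)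
    finally have "set (i # js) \<notin> E" using card_edge assms(1) by force
    then show ?thesis by (simp add: adjacency_tensor_def)
  next
    case False
    then have "0 \<in> set (map x js)" by (auto simp: x_def image_iff)
    then show ?thesis by (simp add: prod_list_zero_iff)
  qed
  then have "(\<Sum>js | set js \<subseteq> V \<and> length js = k - 1.
      adjacency_tensor k E (i # js) * prod_list (map x js)) = 0 * x i ^ (k - 1)" for i
    by (subst sum.neutral) auto
  moreover have "x v \<noteq> 0" by (simp add: x_def)
  ultimately show ?thesis
    unfolding tensor_eigenvalue_def using v by blast
qed

end

theorem theorem4p3:
  fixes n k s t :: nat and V :: "'a set" and E :: "'a set set"
  assumes "n \<ge> 3" and "k \<ge> 3" and "s \<ge> 2"
    and "1 \<le> t"
    and "real t \<le> 1 / 2 * (6 * real k ^ 2 - 15 * real k + 10) * (real s - 1) + 1"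
    and "k_graph k V E" and "card V = n"
    and "linear_hypergraph E" and "connected_hypergraph V E"
    and "\<not> contains_berge V E (book_graph s)"
    and "\<not> contains_berge V E (complete_bipartite_graph 2 t)"
  shows "hypergraph_spectral_radius k V E
    \<le> sqrt ((6 * real k ^ 2 - 15 * real k + 10) * (real s - 1) * (real n - 1)
             / (2 * (real k - 1) ^ 2))"
proof -
  interpret linear_k_graph k V E using assms by unfold_locales
  define C where "C = 1 / 2 * (6 * real k ^ 2 - 15 * real k + 10) * (real s - 1)"
  define \<tau> where "\<tau> = (s - 1) * (2 * k - 3)"
  have k2: "k \<ge> 2" and "s \<ge> 1" using assms by auto
  have tau: "card (apexes x y) \<le> \<tau>" if "y \<in> nbhd x" for x y
    unfolding \<tau>_def by (rule card_apexes_le) fact+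
  have sep: "card S \<le> t - 1" if "v \<in> V" "u \<in> V" "u \<noteq> v" "separated v u S" for u v S
  proof (rule ccontr)
    assume "\<not> card S \<le> t - 1"
    then have "t \<le> card S" by simp
    then obtain S' where "S' \<subseteq> S" "card S' = t" using obtain_subset_with_card_n by metis
    then show False
      using separated_imp_complete_bipartite[OF separated_subset[OF that(4)]] that assms(11) by blast
  qed
  have coeff: "real ((k - 1) + \<tau> + (k - 2) * \<tau>) \<le> C"
  proof -
    \<comment> \<open>In terms of \<open>a\<close> and \<open>b\<close>, the difference of the two
      sides is a polynomial with nonnegative coefficients.\<close>
    define a where "a = real k - 2"
    define b where "b = real s - 2"
    have ab: "a \<ge> 1" "b \<ge> 0" "real k = a + 2" "real s = b + 2" using assms by (auto simp: a_def b_def)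
    have "real ((k - 1) + \<tau> + (k - 2) * \<tau>) = (a + 1) + (b + 1) * (2 * a + 1) * (1 + a)"
    proof -
      have "real (k - 1) = a + 1" "real (k - 2) = a" "real (s - 1) = b + 1" "real (2 * k - 3) = 2 * a + 1"
        using assms(2,3) by (simp_all add: a_def b_def of_nat_diff)
      then show ?thesis by (simp only: \<tau>_def of_nat_add of_nat_mult) (simp only: algebra_simps mult_1_left mult_1_right)
    qed
    moreover have "C - ((a + 1) + (b + 1) * (2 * a + 1) * (1 + a))
        = a * (a + 1 / 2) + b * (a * a + 3 / 2 * a + 1)"
      by (simp add: C_def ab power2_eq_square algebra_simps)
    moreover have "0 \<le> a * (a + 1 / 2) + b * (a * a + 3 / 2 * a + 1)"
      using ab by (intro add_nonneg_nonneg mult_nonneg_nonneg) auto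
    ultimately show ?thesis by linarith
  qed
  \<comment> \<open>This is the assumed upper bound on \<open>t\<close>.\<close>
  have tC: "real (t - 1) \<le> C" using assms by (simp add: C_def of_nat_diff)
  have walks: "(\<Sum>w\<in>nbhd v. real (card (nbhd w))) \<le> C * (real n - 1)" if v: "v \<in> V" for v
  proof -
    \<comment> \<open>This makes the truncated subtraction in the walk count exact and its value a
      nonnegative weight.\<close>
    have le: "card (nbhd v) \<le> n - 1"
      using card_mono[OF _ nbhd_subset[of v]] v assms by simp
    have "(\<Sum>w\<in>nbhd v. real (card (nbhd w)))
      \<le> real (card (nbhd v) * ((k - 1) + \<tau> + (k - 2) * \<tau>) + (card V - 1 - card (nbhd v)) * (t - 1))"
      unfolding of_nat_sum[symmetric] of_nat_le_iff
      using two_walks_le[OF k2 v, of \<tau> "t - 1"] tau sep[OF v] by blast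
    also have "\<dots> = real (card (nbhd v)) * real ((k - 1) + \<tau> + (k - 2) * \<tau>)
        + (real n - 1 - real (card (nbhd v))) * real (t - 1)"
      using le assms by (simp add: of_nat_diff)
    \<comment> \<open>Neighbours and non-neighbours of \<open>v\<close> now carry the same weight
      \<open>C\<close>, and together they number \<open>n - 1\<close>.\<close>
    also have "\<dots> \<le> real (card (nbhd v)) * C + (real n - 1 - real (card (nbhd v))) * C"
      using coeff tC le assms by (intro add_mono mult_left_mono) auto
    also have "\<dots> = C * (real n - 1)" by (simp add: algebra_simps)
    finally show ?thesis .
  qed
  have "cmod c \<le> sqrt ((6 * real k ^ 2 - 15 * real k + 10) * (real s - 1) * (real n - 1)
             / (2 * (real k - 1) ^ 2))" if "tensor_eigenvalue k V (adjacency_tensor k E) c" for c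
  proof (rule real_le_rsqrt)
    have "((real k - 1) * cmod c)\<^sup>2 \<le> C * (real n - 1)"
      using eigenvalue_two_walk_bound[OF k2 that walks] .
    then show "(cmod c)\<^sup>2 \<le> (6 * real k ^ 2 - 15 * real k + 10) * (real s - 1) * (real n - 1)
             / (2 * (real k - 1) ^ 2)"
      using k2 by (simp add: C_def pos_le_divide_eq power_mult_distrib mult_ac)
  qed
  moreover have "V \<noteq> {}" using assms by auto
  ultimately show ?thesis
    unfolding hypergraph_spectral_radius_def tensor_spectral_radius_def
    using zero_eigenvalue assms(2) by (intro cSup_least) auto
qed

end
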